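(* Let $\Delta\subseteq \mathrm{Fm}$ be a set of LTP-formulas and $\psi\in\mathrm{Fm}$. If $\Delta\vDash\psi$, then $\sigma(\Delta)\vDash\sigma(\psi)$ for every algebra homomorphism $\sigma:\mathrm{Fm}\to\mathrm{Fm}$, where $\sigma(\Delta)=\{\sigma(\delta)\mid\delta\in\Delta\}$.
   Context: Boolean algebras $B$ are written with operations $0,1,-,+,\cdot$ (bottom, top, complement, join, meet); the one-element Boolean algebra is allowed. The powerset $\mathcal{P}(B)$ carries external operations $\bot=\emptyset$, $\neg X=B\setminus X$, $X\vee Y=X\cup Y$, $X\wedge Y=X\cap Y$, and internal operations $\dot\bot=\{0\}$, $\dot\neg X=\{-a\mid a\in X\}$, $X\mathbin{\dot\vee}Y=\{a+b\mid a\in X,b\in Y\}$, $X\mathbin{\dot\wedge}Y=\{a\cdot b\mid a\in X,b\in Y\}$. The formulas of LTP (Logic of Team Properties) form the absolutely free algebra $\mathrm{Fm}$ generated by propositional variables $P_0,P_1,\dots$ using constants $\bot,\dot\bot$, unary $\neg,\dot\neg$, and binary $\vee,\wedge,\dot\vee,\dot\wedge$. Homomorphisms $\mathrm{Fm}\to\mathcal{P}(B)$ and $\mathrm{Fm}\to\mathrm{Fm}$ preserve all eight operations. Entailment: $\Delta\vDash\psi$ iff for all Boolean algebras $B$ and all homomorphisms $H:\mathrm{Fm}\to\mathcal{P}(B)$, $\bigcap_{\phi\in\Delta}H(\phi)\subseteq H(\psi)$ (the empty intersection being $B$). *)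

theory Defs
  imports Main "HOL-Library.Countable_Set"
begin

section \<open>Boolean algebras with an explicit carrier\<close>

record 'a balg =
  Elems :: "'a set"
  Zero :: 'a
  One :: 'a
  Compl :: "'a \<Rightarrow> 'a"
  Join :: "'a \<Rightarrow> 'a \<Rightarrow> 'a"
  Meet :: "'a \<Rightarrow> 'a \<Rightarrow> 'a"

text \<open>
  The axioms are those of the library locale \<^locale>\<open>abstract_boolean_algebra\<close>, relativised to the
  carrier; \<open>Zero B \<noteq> One B\<close> is not required, so the one-element algebra is included.
\<close>

locale carrier_boolean_algebra =
  fixes B :: "'a balg"
  assumes Zero_closed: "Zero B \<in> Elems B"
    and One_closed: "One B \<in> Elems B"
    and Compl_closed: "a \<in> Elems B \<Longrightarrow> Compl B a \<in> Elems B"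
    and Join_closed: "a \<in> Elems B \<Longrightarrow> b \<in> Elems B \<Longrightarrow> Join B a b \<in> Elems B"
    and Meet_closed: "a \<in> Elems B \<Longrightarrow> b \<in> Elems B \<Longrightarrow> Meet B a b \<in> Elems B"
    and Join_assoc: "a \<in> Elems B \<Longrightarrow> b \<in> Elems B \<Longrightarrow> c \<in> Elems B \<Longrightarrow>
      Join B (Join B a b) c = Join B a (Join B b c)"
    and Meet_assoc: "a \<in> Elems B \<Longrightarrow> b \<in> Elems B \<Longrightarrow> c \<in> Elems B \<Longrightarrow>
      Meet B (Meet B a b) c = Meet B a (Meet B b c)"
    and Join_commute: "a \<in> Elems B \<Longrightarrow> b \<in> Elems B \<Longrightarrow> Join B a b = Join B b a"
    and Meet_commute: "a \<in> Elems B \<Longrightarrow> b \<in> Elems B \<Longrightarrow> Meet B a b = Meet B b a"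
    and Meet_Join_distrib: "a \<in> Elems B \<Longrightarrow> b \<in> Elems B \<Longrightarrow> c \<in> Elems B \<Longrightarrow>
      Meet B a (Join B b c) = Join B (Meet B a b) (Meet B a c)"
    and Join_Meet_distrib: "a \<in> Elems B \<Longrightarrow> b \<in> Elems B \<Longrightarrow> c \<in> Elems B \<Longrightarrow>
      Join B a (Meet B b c) = Meet B (Join B a b) (Join B a c)"
    and Join_Zero: "a \<in> Elems B \<Longrightarrow> Join B a (Zero B) = a"
    and Meet_One: "a \<in> Elems B \<Longrightarrow> Meet B a (One B) = a"
    and Join_Compl: "a \<in> Elems B \<Longrightarrow> Join B a (Compl B a) = One B"
    and Meet_Compl: "a \<in> Elems B \<Longrightarrow> Meet B a (Compl B a) = Zero B"

lemma carrier_boolean_algebra_UNIV_iff: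
  "carrier_boolean_algebra
      \<lparr>Elems = UNIV, Zero = z, One = u, Compl = c, Join = j, Meet = m\<rparr> \<longleftrightarrow>
   abstract_boolean_algebra m j c z u"
  unfolding carrier_boolean_algebra_def abstract_boolean_algebra_def
    abstract_boolean_algebra_axioms_def abel_semigroup_def abel_semigroup_axioms_def
    semigroup_def
  by auto

section \<open>Algebras of the signature of LTP and their homomorphisms\<close>

text \<open>
  Constants \<open>Bot\<close>, \<open>DBot\<close> stand for \<open>\<bottom>\<close> and dotted \<open>\<bottom>\<close>, and similarly for the other symbols:
  the prefix \<open>D\<close> (or the suffix \<open>d\<close> of a field name) marks the dotted (internal) version.
\<close>

record 'a ltp_algebra =
  Univ :: "'a set"
  bt :: 'a
  btd :: 'a
  ng :: "'a \<Rightarrow> 'a"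
  ngd :: "'a \<Rightarrow> 'a"
  vee :: "'a \<Rightarrow> 'a \<Rightarrow> 'a"
  wdg :: "'a \<Rightarrow> 'a \<Rightarrow> 'a"
  veed :: "'a \<Rightarrow> 'a \<Rightarrow> 'a"
  wdgd :: "'a \<Rightarrow> 'a \<Rightarrow> 'a"

definition ltp_hom :: "'a ltp_algebra \<Rightarrow> 'b ltp_algebra \<Rightarrow> ('a \<Rightarrow> 'b) set" where
  "ltp_hom A C = {h.
     (\<forall>x\<in>Univ A. h x \<in> Univ C) \<and>
     h (bt A) = bt C \<and>
     h (btd A) = btd C \<and>
     (\<forall>x\<in>Univ A. h (ng A x) = ng C (h x)) \<and>
     (\<forall>x\<in>Univ A. h (ngd A x) = ngd C (h x)) \<and>
     (\<forall>x\<in>Univ A. \<forall>y\<in>Univ A. h (vee A x y) = vee C (h x) (h y)) \<and>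
     (\<forall>x\<in>Univ A. \<forall>y\<in>Univ A. h (wdg A x y) = wdg C (h x) (h y)) \<and>
     (\<forall>x\<in>Univ A. \<forall>y\<in>Univ A. h (veed A x y) = veed C (h x) (h y)) \<and>
     (\<forall>x\<in>Univ A. \<forall>y\<in>Univ A. h (wdgd A x y) = wdgd C (h x) (h y))}"

datatype fm =
    PVar nat
  | Bot
  | DBot
  | Neg fm
  | DNeg fm
  | Or fm fm
  | And fm fm
  | DOr fm fm
  | DAnd fm fm

definition Fm :: "fm ltp_algebra" where
  "Fm = \<lparr>Univ = UNIV, bt = Bot, btd = DBot, ng = Neg, ngd = DNeg,
         vee = Or, wdg = And, veed = DOr, wdgd = DAnd\<rparr>"

definition Pw :: "'a balg \<Rightarrow> 'a set ltp_algebra" where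
  "Pw B = \<lparr>Univ = Pow (Elems B),
     bt = {},
     btd = {Zero B},
     ng = (\<lambda>X. Elems B - X),
     ngd = (\<lambda>X. {Compl B a | a. a \<in> X}),
     vee = (\<lambda>X Y. X \<union> Y),
     wdg = (\<lambda>X Y. X \<inter> Y),
     veed = (\<lambda>X Y. {Join B a b | a b. a \<in> X \<and> b \<in> Y}),
     wdgd = (\<lambda>X Y. {Meet B a b | a b. a \<in> X \<and> b \<in> Y})\<rparr>"

section \<open>Entailment\<close>

text \<open>
  HOL cannot quantify over types inside a formula, so ``all Boolean algebras'' is rendered as: all
  Boolean algebras whose carrier is a subset of the type \<open>'a\<close>, for a type \<open>'a\<close> that is left
  arbitrary. Intersecting with \<open>Elems B\<close> makes the empty intersection equal to the carrier.
\<close>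

definition entails :: "'a itself \<Rightarrow> fm set \<Rightarrow> fm \<Rightarrow> bool" where
  "entails _ \<Delta> \<psi> \<longleftrightarrow>
     (\<forall>B :: 'a balg. carrier_boolean_algebra B \<longrightarrow>
       (\<forall>H \<in> ltp_hom Fm (Pw B). Elems B \<inter> (\<Inter>\<phi>\<in>\<Delta>. H \<phi>) \<subseteq> H \<psi>))"


section \<open>Entailment does not depend on the infinite type\<close>

text \<open>
  A downward Loewenheim-Skolem argument: a counterexample \<open>(B, H, x)\<close> over any type restricts to a
  countable one (the closure of \<open>x\<close> under the operations and under witnesses for membership in the
  dotted operations), which has a copy inside every infinite type. So, for infinite \<open>'a\<close>,
  \<open>entails TYPE('a)\<close> is entailment over all Boolean algebras on all types.
\<close>

lemma ltp_hom_Fm_Pw: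
  "H \<in> ltp_hom Fm (Pw B) \<longleftrightarrow>
    (\<forall>\<phi>. H \<phi> \<subseteq> Elems B) \<and> H Bot = {} \<and> H DBot = {Zero B} \<and>
    (\<forall>\<phi>. H (Neg \<phi>) = Elems B - H \<phi>) \<and>
    (\<forall>\<phi>. H (DNeg \<phi>) = {Compl B a | a. a \<in> H \<phi>}) \<and>
    (\<forall>\<phi> \<chi>. H (Or \<phi> \<chi>) = H \<phi> \<union> H \<chi>) \<and>
    (\<forall>\<phi> \<chi>. H (And \<phi> \<chi>) = H \<phi> \<inter> H \<chi>) \<and>
    (\<forall>\<phi> \<chi>. H (DOr \<phi> \<chi>) = {Join B a b | a b. a \<in> H \<phi> \<and> b \<in> H \<chi>}) \<and>
    (\<forall>\<phi> \<chi>. H (DAnd \<phi> \<chi>) = {Meet B a b | a b. a \<in> H \<phi> \<and> b \<in> H \<chi>})"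
  by (auto simp: ltp_hom_def Fm_def Pw_def)

lemma countable_closure:
  fixes F :: "('b \<Rightarrow> 'b \<Rightarrow> 'b) set"
  assumes "countable F"
  shows "\<exists>S. countable S \<and> x \<in> S \<and> (\<forall>f\<in>F. \<forall>a\<in>S. \<forall>b\<in>S. f a b \<in> S) \<and>
    (\<forall>T. x \<in> T \<longrightarrow> (\<forall>f\<in>F. \<forall>a\<in>T. \<forall>b\<in>T. f a b \<in> T) \<longrightarrow> S \<subseteq> T)"
proof -
  define step where "step X = X \<union> (\<lambda>(f, a, b). f a b) ` (F \<times> X \<times> X)" for X
  define G where "G n = (step ^^ n) {x}" for n
  have G_Suc: "G (Suc n) = step (G n)" for n
    by (simp add: G_def)
  have mono: "G m \<subseteq> G n" if "m \<le> n" for m n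
    using that by (rule lift_Suc_mono_le[rotated]) (auto simp: G_Suc step_def)
  have "countable (G n)" for n
  proof (induction n)
    case 0
    show ?case by (simp add: G_def)
  next
    case (Suc n)
    then show ?case
      using assms unfolding G_Suc step_def by auto
  qed
  then have "countable (\<Union>n. G n)"
    by blast
  moreover have "x \<in> (\<Union>n. G n)"
    by (auto simp: G_def intro!: exI[of _ 0])
  moreover have "f a b \<in> (\<Union>n. G n)" if f: "f \<in> F" and "a \<in> (\<Union>n. G n)" "b \<in> (\<Union>n. G n)" for f a b
  proof -
    from that obtain m n where "a \<in> G m" "b \<in> G n"
      by blast
    then have "a \<in> G (max m n)" "b \<in> G (max m n)"
      using mono[of m "max m n"] mono[of n "max m n"] by auto
    then have "f a b \<in> G (Suc (max m n))"
      using f unfolding G_Suc step_def by force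
    then show ?thesis
      by blast
  qed
  moreover have "(\<Union>n. G n) \<subseteq> T"
    if "x \<in> T" and cl: "\<And>f a b. f \<in> F \<Longrightarrow> a \<in> T \<Longrightarrow> b \<in> T \<Longrightarrow> f a b \<in> T" for T
  proof -
    have "G n \<subseteq> T" for n
    proof (induction n)
      case 0
      show ?case using \<open>x \<in> T\<close> by (simp add: G_def)
    next
      case (Suc n)
      have "y \<in> T" if "y \<in> G (Suc n)" for y
      proof -
        from that consider "y \<in> G n" | f a b where "f \<in> F" "a \<in> G n" "b \<in> G n" "y = f a b"
          unfolding G_Suc step_def by auto
        then show ?thesis
        proof cases
          case 2
          then show ?thesis
            using Suc cl[of f a b] by auto
        qed (use Suc in auto)
      qed
      then show ?case
        by blast
    qed
    then show ?thesis
      by blast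
  qed
  ultimately show ?thesis
    by (intro exI[of _ "\<Union>n. G n"] conjI allI impI ballI) auto
qed

instance fm :: countable
  by countable_datatype

proposition entails_infinite_type:
  fixes \<Delta> :: "fm set" and \<psi> :: fm
  assumes inf: "infinite (UNIV :: 'a set)" and ent: "entails TYPE('a) \<Delta> \<psi>"
  shows "entails TYPE('b) \<Delta> \<psi>"
  unfolding entails_def
proof (intro allI impI ballI subsetI)
  fix B :: "'b balg" and H :: "fm \<Rightarrow> 'b set" and x
  assume "carrier_boolean_algebra B" and H: "H \<in> ltp_hom Fm (Pw B)"
    and x: "x \<in> Elems B \<inter> (\<Inter>\<phi>\<in>\<Delta>. H \<phi>)"
  interpret B: carrier_boolean_algebra B by fact
  have H_sub: "H \<phi> \<subseteq> Elems B" for \<phi>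
    using H unfolding ltp_hom_Fm_Pw by simp
  have hom: "H Bot = {}" "H DBot = {Zero B}" "H (Neg \<phi>) = Elems B - H \<phi>"
    "H (DNeg \<phi>) = {Compl B a | a. a \<in> H \<phi>}"
    "H (Or \<phi> \<chi>) = H \<phi> \<union> H \<chi>" "H (And \<phi> \<chi>) = H \<phi> \<inter> H \<chi>"
    "H (DOr \<phi> \<chi>) = {Join B a b | a b. a \<in> H \<phi> \<and> b \<in> H \<chi>}"
    "H (DAnd \<phi> \<chi>) = {Meet B a b | a b. a \<in> H \<phi> \<and> b \<in> H \<chi>}" for \<phi> \<chi>
    using H unfolding ltp_hom_Fm_Pw by simp_all
  define w where "w f \<phi> \<chi> a = (if \<exists>p. fst p \<in> H \<phi> \<and> snd p \<in> H \<chi> \<and> a = f (fst p) (snd p)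
      then SOME p. fst p \<in> H \<phi> \<and> snd p \<in> H \<chi> \<and> a = f (fst p) (snd p) else (x, x))"
    for f :: "'b \<Rightarrow> 'b \<Rightarrow> 'b" and \<phi> \<chi> a
  have w: "fst (w f \<phi> \<chi> a) \<in> H \<phi> \<and> snd (w f \<phi> \<chi> a) \<in> H \<chi> \<and>
      a = f (fst (w f \<phi> \<chi> a)) (snd (w f \<phi> \<chi> a))"
    if "b \<in> H \<phi>" "c \<in> H \<chi>" "a = f b c" for f :: "'b \<Rightarrow> 'b \<Rightarrow> 'b" and \<phi> \<chi> a b c
  proof -
    have ex: "\<exists>p. fst p \<in> H \<phi> \<and> snd p \<in> H \<chi> \<and> a = f (fst p) (snd p)"
      using that by (intro exI[of _ "(b, c)"]) simp
    show ?thesis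
      using someI_ex[OF ex] ex by (simp add: w_def)
  qed
  have w_in: "fst (w f \<phi> \<chi> a) \<in> Elems B \<and> snd (w f \<phi> \<chi> a) \<in> Elems B" for f \<phi> \<chi> a
  proof (cases "\<exists>p. fst p \<in> H \<phi> \<and> snd p \<in> H \<chi> \<and> a = f (fst p) (snd p)")
    case True
    then obtain p where "fst p \<in> H \<phi>" "snd p \<in> H \<chi>" "a = f (fst p) (snd p)"
      by blast
    from w[of "fst p" \<phi> "snd p" \<chi> a f, OF this] show ?thesis
      using H_sub by blast
  next
    case False
    then have "w f \<phi> \<chi> a = (x, x)" unfolding w_def by (rule if_not_P)
    then show ?thesis using x by simp
  qed
  define ops where "ops = {\<lambda>a b. Zero B, \<lambda>a b. One B, \<lambda>a b. Compl B a, Join B, Meet B}"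
  define wit :: "('b \<Rightarrow> 'b \<Rightarrow> 'b) set" where "wit =
    (\<lambda>(\<phi>, \<chi>, f) a b. fst (w f \<phi> \<chi> a)) ` (UNIV \<times> UNIV \<times> {Join B, Meet B, \<lambda>a b. Compl B a}) \<union>
    (\<lambda>(\<phi>, \<chi>, f) a b. snd (w f \<phi> \<chi> a)) ` (UNIV \<times> UNIV \<times> {Join B, Meet B})"
  have "countable (ops \<union> wit)"
    by (auto simp: ops_def wit_def)
  from countable_closure[OF this, of x]
  obtain S where S: "countable S" "x \<in> S"
    and Sc': "\<forall>f\<in>ops \<union> wit. \<forall>a\<in>S. \<forall>b\<in>S. f a b \<in> S"
    and Smin: "\<forall>T. x \<in> T \<longrightarrow> (\<forall>f\<in>ops \<union> wit. \<forall>a\<in>T. \<forall>b\<in>T. f a b \<in> T) \<longrightarrow> S \<subseteq> T"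
    by (elim exE conjE)
  have Sc: "f a b \<in> S" if "f \<in> ops \<union> wit" "a \<in> S" "b \<in> S" for f a b
    using Sc' that by blast
  have SB: "S \<subseteq> Elems B"
  proof (rule Smin[rule_format])
    show "x \<in> Elems B"
      using x by simp
    show "f a b \<in> Elems B" if "f \<in> ops \<union> wit" "a \<in> Elems B" "b \<in> Elems B" for f a b
      using that unfolding ops_def wit_def
      by (auto simp: w_in B.Zero_closed B.One_closed B.Compl_closed B.Join_closed B.Meet_closed)
  qed
  have S0: "Zero B \<in> S" and S1: "One B \<in> S"
    using Sc[of "\<lambda>a b. Zero B" x x] Sc[of "\<lambda>a b. One B" x x] S(2) by (auto simp: ops_def)
  have SCompl: "a \<in> S \<Longrightarrow> Compl B a \<in> S" for a
    using Sc[of "\<lambda>a b. Compl B a" a a] by (auto simp: ops_def)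
  have SJ: "a \<in> S \<Longrightarrow> b \<in> S \<Longrightarrow> Join B a b \<in> S" for a b
    using Sc[of "Join B" a b] by (auto simp: ops_def)
  have SM: "a \<in> S \<Longrightarrow> b \<in> S \<Longrightarrow> Meet B a b \<in> S" for a b
    using Sc[of "Meet B" a b] by (auto simp: ops_def)
  have Sw: "fst (w f \<phi> \<chi> a) \<in> S"
    if "a \<in> S" "f \<in> {Join B, Meet B, \<lambda>a b. Compl B a}" for f \<phi> \<chi> a
  proof -
    have "(\<lambda>a b. fst (w f \<phi> \<chi> a)) \<in> wit"
      unfolding wit_def using that(2)
      by (intro UnI1 image_eqI[of _ _ "(\<phi>, \<chi>, f)"]) simp_all
    then show ?thesis
      using Sc[of "\<lambda>a b. fst (w f \<phi> \<chi> a)" a a] that(1) by simp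
  qed
  have Sw': "snd (w f \<phi> \<chi> a) \<in> S"
    if "a \<in> S" "f \<in> {Join B, Meet B}" for f \<phi> \<chi> a
  proof -
    have "(\<lambda>a b. snd (w f \<phi> \<chi> a)) \<in> wit"
      unfolding wit_def using that(2)
      by (intro UnI2 image_eqI[of _ _ "(\<phi>, \<chi>, f)"]) simp_all
    then show ?thesis
      using Sc[of "\<lambda>a b. snd (w f \<phi> \<chi> a)" a a] that(1) by simp
  qed
  have wJM: "\<exists>b\<in>H \<phi> \<inter> S. \<exists>c\<in>H \<chi> \<inter> S. a = f b c"
    if "a \<in> S" "b \<in> H \<phi>" "c \<in> H \<chi>" "a = f b c" "f \<in> {Join B, Meet B}"
    for f :: "'b \<Rightarrow> 'b \<Rightarrow> 'b" and \<phi> \<chi> a b c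
    using w[of b \<phi> c \<chi> a f, OF that(2-4)] Sw[OF that(1), of f \<phi> \<chi>]
      Sw'[OF that(1,5), of \<phi> \<chi>] that(5) by blast
  have wC: "\<exists>b\<in>H \<phi> \<inter> S. a = Compl B b" if "a \<in> S" "b \<in> H \<phi>" "a = Compl B b" for \<phi> a b
    using w[of b \<phi> b \<phi> a "\<lambda>a b. Compl B a", OF that(2) that(2) that(3)]
      Sw[OF that(1), of "\<lambda>a b. Compl B a" \<phi> \<phi>]
    by blast
  obtain g :: "nat \<Rightarrow> 'a" where g: "inj g"
    using infinite_countable_subset[OF inf] by blast
  define e where "e = g \<circ> to_nat_on S"
  define d where "d = inv_into S e"
  have e: "inj_on e S"
    unfolding e_def using S(1) g by (intro comp_inj_on inj_on_to_nat_on) (auto intro: inj_on_subset)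
  have de: "a \<in> S \<Longrightarrow> d (e a) = a" for a
    using e by (simp add: d_def)
  define B' where "B' = \<lparr>Elems = e ` S, Zero = e (Zero B), One = e (One B),
    Compl = (\<lambda>a. e (Compl B (d a))), Join = (\<lambda>a b. e (Join B (d a) (d b))),
    Meet = (\<lambda>a b. e (Meet B (d a) (d b)))\<rparr>"
  have "carrier_boolean_algebra B'"
    using SB
    by unfold_locales
      (auto simp: B'_def de S0 S1 SCompl SJ SM subset_iff intro!: arg_cong[where f = e]
        B.Join_assoc B.Meet_assoc B.Join_commute B.Meet_commute B.Meet_Join_distrib
        B.Join_Meet_distrib B.Join_Zero B.Meet_One B.Join_Compl B.Meet_Compl)
  moreover have "(\<lambda>\<phi>. e ` (H \<phi> \<inter> S)) \<in> ltp_hom Fm (Pw B')"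
    unfolding ltp_hom_Fm_Pw
  proof (intro conjI allI)
    fix \<phi> \<chi>
    show "e ` (H (Neg \<phi>) \<inter> S) = Elems B' - e ` (H \<phi> \<inter> S)"
      using SB e by (auto simp: hom B'_def inj_on_eq_iff)
    show "e ` (H (And \<phi> \<chi>) \<inter> S) = e ` (H \<phi> \<inter> S) \<inter> e ` (H \<chi> \<inter> S)"
      using e by (auto simp: hom inj_on_eq_iff)
    show "e ` (H (DNeg \<phi>) \<inter> S) = {Compl B' a | a. a \<in> e ` (H \<phi> \<inter> S)}" (is "?L = ?R")
    proof
      show "?L \<subseteq> ?R"
      proof
        fix y assume "y \<in> ?L"
        then obtain a b where "a \<in> S" "b \<in> H \<phi>" "a = Compl B b" "y = e a"
          by (auto simp: hom)
        with wC[of a b \<phi>] obtain c where "c \<in> H \<phi> \<inter> S" "y = e (Compl B c)"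
          by auto
        then show "y \<in> ?R"
          by (auto simp: B'_def intro!: exI[of _ "e c"] simp: de)
      qed
      show "?R \<subseteq> ?L"
        by (auto simp: hom B'_def de SCompl)
    qed
    show "e ` (H (DOr \<phi> \<chi>) \<inter> S) = {Join B' a b | a b. a \<in> e ` (H \<phi> \<inter> S) \<and> b \<in> e ` (H \<chi> \<inter> S)}"
      (is "?L = ?R")
    proof
      show "?L \<subseteq> ?R"
      proof
        fix y assume "y \<in> ?L"
        then obtain a b c where "a \<in> S" "b \<in> H \<phi>" "c \<in> H \<chi>" "a = Join B b c" "y = e a"
          by (auto simp: hom)
        with wJM[of a b \<phi> c \<chi> "Join B"]
        obtain b' c' where "b' \<in> H \<phi> \<inter> S" "c' \<in> H \<chi> \<inter> S" "y = e (Join B b' c')"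
          by auto
        then have "y = Join B' (e b') (e c')" "e b' \<in> e ` (H \<phi> \<inter> S)" "e c' \<in> e ` (H \<chi> \<inter> S)"
          by (auto simp: B'_def de)
        then show "y \<in> ?R"
          by blast
      qed
      show "?R \<subseteq> ?L"
        by (auto simp: hom B'_def de SJ intro!: imageI) blast
    qed
    show "e ` (H (DAnd \<phi> \<chi>) \<inter> S) = {Meet B' a b | a b. a \<in> e ` (H \<phi> \<inter> S) \<and> b \<in> e ` (H \<chi> \<inter> S)}"
      (is "?L = ?R")
    proof
      show "?L \<subseteq> ?R"
      proof
        fix y assume "y \<in> ?L"
        then obtain a b c where "a \<in> S" "b \<in> H \<phi>" "c \<in> H \<chi>" "a = Meet B b c" "y = e a"
          by (auto simp: hom)
        with wJM[of a b \<phi> c \<chi> "Meet B"]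
        obtain b' c' where "b' \<in> H \<phi> \<inter> S" "c' \<in> H \<chi> \<inter> S" "y = e (Meet B b' c')"
          by auto
        then have "y = Meet B' (e b') (e c')" "e b' \<in> e ` (H \<phi> \<inter> S)" "e c' \<in> e ` (H \<chi> \<inter> S)"
          by (auto simp: B'_def de)
        then show "y \<in> ?R"
          by blast
      qed
      show "?R \<subseteq> ?L"
        by (auto simp: hom B'_def de SM intro!: imageI) blast
    qed
  qed (use S0 in \<open>auto simp: B'_def hom\<close>)
  ultimately have "Elems B' \<inter> (\<Inter>\<phi>\<in>\<Delta>. e ` (H \<phi> \<inter> S)) \<subseteq> e ` (H \<psi> \<inter> S)"
    using ent unfolding entails_def by blast
  moreover have "e x \<in> Elems B' \<inter> (\<Inter>\<phi>\<in>\<Delta>. e ` (H \<phi> \<inter> S))"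
    using x S(2) by (auto simp: B'_def)
  ultimately have "e x \<in> e ` (H \<psi> \<inter> S)"
    by blast
  then show "x \<in> H \<psi>"
    using S(2) e by (auto simp: inj_on_eq_iff)
qed

end

theory Submission
  imports Defs
begin

text \<open>Entailment quantifies over every homomorphism into \<open>Pw B\<close>, and precomposing
  such an \<open>H\<close> with a substitution \<open>\<sigma>\<close> gives another one, by
  \<open>ltp_hom_comp\<close>. So the claim for \<open>H\<close> is the hypothesis for
  \<open>H \<circ> \<sigma>\<close>. The algebra \<open>B\<close> does not change, so the type
  \<open>'a\<close> stays the same.\<close>

lemma ltp_hom_comp:
  assumes "g \<in> ltp_hom A B" "h \<in> ltp_hom B C"
  shows "h \<circ> g \<in> ltp_hom A C"
  using assms unfolding ltp_hom_def by simp

theorem theorem2p7: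
  fixes \<Delta> :: "fm set" and \<psi> :: fm
  assumes "entails TYPE('a) \<Delta> \<psi>"
  shows "\<forall>\<sigma> \<in> ltp_hom Fm Fm. entails TYPE('a) {\<sigma> \<delta> | \<delta>. \<delta> \<in> \<Delta>} (\<sigma> \<psi>)"
  unfolding entails_def
proof (intro ballI allI impI)
  fix \<sigma> and B :: "'a balg" and H
  assume \<sigma>: "\<sigma> \<in> ltp_hom Fm Fm" and B: "carrier_boolean_algebra B"
    and H: "H \<in> ltp_hom Fm (Pw B)"
  have "Elems B \<inter> (\<Inter>\<phi>\<in>\<Delta>. (H \<circ> \<sigma>) \<phi>) \<subseteq> (H \<circ> \<sigma>) \<psi>"
    using assms B ltp_hom_comp[OF \<sigma> H] unfolding entails_def by blast
  \<comment> \<open>Intersecting \<open>H\<close> over the image of \<open>\<Delta>\<close> under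
    \<open>\<sigma>\<close> is intersecting \<open>H \<circ> \<sigma>\<close> over
    \<open>\<Delta>\<close>.\<close>
  then show "Elems B \<inter> (\<Inter>\<phi>\<in>{\<sigma> \<delta> | \<delta>. \<delta> \<in> \<Delta>}. H \<phi>) \<subseteq> H (\<sigma> \<psi>)"
    by auto
qed

end
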